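(* Let $b\in\mathbb{R}^n$ and let $T\in\mathbb{R}^{n\times n}$ be a nonsingular matrix. Assume that the matrix $P(x)+T$ is nonsingular for all $x\in\mathbb{R}^n$. Then the sequence $\{x^k\}$ given by $$[P(x^k)+T]\,x^{k+1}=b,\qquad k=0,1,\ldots,$$ is well defined and bounded from any starting point $x^0\in\mathbb{R}^n$. Moreover, for each accumulation point $\bar x$ of $\{x^k\}$ there exists an $\hat x\in\mathbb{R}^n$ such that $$[P(\hat x)+T]\,\bar x=b.$$ In particular, if $\mathrm{sgn}(\bar x^+)=\mathrm{sgn}(\hat x^+)$, then $\bar x$ is a solution of the equation $x^+ + Tx=b$.
   Context: For $x\in\mathbb{R}^n$, $x^+$ is the vector with $i$-th component $\max\{x_i,0\}$. $\mathrm{sgn}(x)$ is the vector whose $i$-th component is $1$, $0$ or $-1$ according to whether $x_i$ is positive, zero or negative. $\mathrm{diag}(x)$ is the diagonal matrix with $(i,i)$-th entry $x_i$, and $P(x):=\mathrm{diag}(\mathrm{sgn}(x^+))$. "Well defined" means that at each step the linear system for $x^{k+1}$ has exactly one solution. *)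

theory Defs
  imports "HOL-Analysis.Analysis"
begin

definition pos_vec :: "real^'n \<Rightarrow> real^'n" where
  "pos_vec x = (\<chi> i. max (x $ i) 0)"

text \<open>On vectors, the library's \<open>sgn\<close> is the normalisation \<open>x /\<^sub>R norm x\<close>; the sign
  vector applies the real \<open>sgn\<close> to each component.\<close>

definition sgn_vec :: "real^'n \<Rightarrow> real^'n" where
  "sgn_vec x = (\<chi> i. sgn (x $ i))"

definition diag_mat :: "real^'n \<Rightarrow> real^'n^'n" where
  "diag_mat x = (\<chi> i j. if i = j then x $ i else 0)"

definition P_mat :: "real^'n \<Rightarrow> real^'n^'n" where
  "P_mat x = diag_mat (sgn_vec (pos_vec x))"

definition iteration_from ::
    "real^'n^'n \<Rightarrow> real^'n \<Rightarrow> real^'n \<Rightarrow> (nat \<Rightarrow> real^'n) \<Rightarrow> bool" where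
  "iteration_from T b x0 x \<longleftrightarrow>
     x 0 = x0 \<and> (\<forall>k. (P_mat (x k) + T) *v x (Suc k) = b)"

text \<open>Accumulation points are those of the sequence, not of its range: a value taken
  infinitely often counts.\<close>

definition accumulation_point :: "(nat \<Rightarrow> 'a::metric_space) \<Rightarrow> 'a \<Rightarrow> bool" where
  "accumulation_point x l \<longleftrightarrow> (\<exists>r. strict_mono r \<and> (x \<circ> r) \<longlonglongrightarrow> l)"

end

theory Submission
  imports Defs
begin

text \<open>The matrix \<open>P(x)\<close> depends only on the set of positive components of \<open>x\<close>, so it takes
  finitely many values. Hence the iterates after \<open>x\<^sup>0\<close> lie in the finite set of solutions \<open>y\<close> of the
  systems \<open>[P(z) + T] y = b\<close>. A finite set is bounded and closed, so it also contains every
  accumulation point.\<close>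

text \<open>Turns unique solvability into an explicit formula, which serves the uniqueness of each
  step, the finiteness of the solution set and the recursion for the iterates.\<close>

lemma invertible_matrix_vector_eq_iff:
  fixes A :: "'a::field^'n^'n"
  assumes "invertible A"
  shows "A *v y = c \<longleftrightarrow> y = matrix_inv A *v c"
proof -
  have "A ** matrix_inv A = mat 1 \<and> matrix_inv A ** A = mat 1"
    using assms unfolding invertible_def matrix_inv_def by (rule someI_ex)
  then have inv: "A *v (matrix_inv A *v z) = z" "matrix_inv A *v (A *v z) = z" for z
    by (simp_all add: matrix_vector_mul_assoc)
  show ?thesis
    using inv(1)[of c] inv(2)[of y] by auto
qed

lemma finite_range_P_mat: "finite (range (P_mat :: real^'n \<Rightarrow> real^'n^'n))"
proof -
  \<comment> \<open>For real \<open>t\<close>, \<open>sgn (max t 0)\<close> is 1 if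
    \<open>t > 0\<close> and 0 otherwise, so the diagonal is the indicator of the set of positive
    components.\<close>
  have eq: "P_mat x = diag_mat (\<chi> i. if i \<in> {i. x $ i > 0} then 1 else 0)" for x :: "real^'n"
    unfolding P_mat_def
    by (rule arg_cong[where f = diag_mat]) (auto simp: sgn_vec_def pos_vec_def vec_eq_iff max_def)
  have "P_mat x \<in> range (\<lambda>S. diag_mat (\<chi> i. if i \<in> S then 1 else 0))" for x :: "real^'n"
    unfolding eq by (rule rangeI)
  then have "range (P_mat :: real^'n \<Rightarrow> real^'n^'n)
      \<subseteq> range (\<lambda>S :: 'n set. diag_mat (\<chi> i. if i \<in> S then 1 else 0))"
    by (rule image_subsetI)
  \<comment> \<open>The index type \<open>'n\<close> is finite, hence so is
    \<open>'n set\<close>.\<close>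
  then show ?thesis
    by (rule finite_subset) simp
qed

text \<open>Componentwise this is \<open>sgn (max t 0) * t = max t 0\<close>. It links the linear
  systems to the equation \<open>pos_vec x + T *v x = b\<close>.\<close>

lemma P_mat_mult_self: "P_mat x *v x = pos_vec x"
proof -
  have "(P_mat x *v x) $ i = pos_vec x $ i" for i
  proof -
    have "(P_mat x *v x) $ i = (\<Sum>j\<in>UNIV. if i = j then sgn (pos_vec x $ i) * x $ i else 0)"
      unfolding matrix_vector_mult_def P_mat_def diag_mat_def sgn_vec_def
      by (simp add: if_distrib[where f = "\<lambda>c. c * _"] cong: if_cong)
    also have "\<dots> = sgn (pos_vec x $ i) * x $ i"
      by simp
    finally show ?thesis
      by (simp add: pos_vec_def max_def sgn_real_def)
  qed
  then show ?thesis
    by (simp add: vec_eq_iff)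
qed

text \<open>Each of the finitely many values of \<open>P_mat\<close> contributes exactly one
  solution.\<close>

lemma finite_P_mat_solutions:
  fixes T :: "real^'n^'n"
  assumes "\<And>x :: real^'n. invertible (P_mat x + T)"
  shows "finite {y. \<exists>z. (P_mat z + T) *v y = b}"
proof -
  have "{y. \<exists>z. (P_mat z + T) *v y = b} = (\<lambda>M. matrix_inv (M + T) *v b) ` range P_mat"
    using invertible_matrix_vector_eq_iff[OF assms] by auto
  then show ?thesis
    by (simp only: finite_imageI[OF finite_range_P_mat])
qed

text \<open>Nonsingularity makes the implicit recursion explicit, so the only sequence is the orbit
  of \<open>x0\<close> under one map.\<close>

lemma ex1_iteration_from:
  fixes T :: "real^'n^'n"
  assumes "\<And>x :: real^'n. invertible (P_mat x + T)"
  shows "\<exists>!x. iteration_from T b x0 x"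
proof -
  define f where "f z = matrix_inv (P_mat z + T) *v b" for z
  have iter: "iteration_from T b x0 x \<longleftrightarrow> x 0 = x0 \<and> (\<forall>k. x (Suc k) = f (x k))" for x
    unfolding iteration_from_def f_def
    by (simp add: invertible_matrix_vector_eq_iff[OF assms])
  show ?thesis
  proof (rule ex1I)
    show "iteration_from T b x0 (\<lambda>k. (f ^^ k) x0)"
      by (simp add: iter)
  next
    fix x assume x: "iteration_from T b x0 x"
    have "x k = (f ^^ k) x0" for k
      using x by (induction k) (simp_all add: iter)
    then show "x = (\<lambda>k. (f ^^ k) x0)"
      by blast
  qed
qed

lemma accumulation_point_in_closed:
  assumes "closed S" and "\<And>k. x (Suc k) \<in> S" and "accumulation_point x l"
  shows "l \<in> S"
proof -
  obtain r where r: "strict_mono r" "(x \<circ> r) \<longlonglongrightarrow> l"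
    using assms(3) unfolding accumulation_point_def by blast
  \<comment> \<open>Only \<open>x 0\<close> may lie outside \<open>S\<close>; since
    \<open>r (Suc k) \<ge> Suc k\<close>, dropping the first term of the subsequence avoids
    it.\<close>
  have "(x \<circ> r) (Suc k) \<in> S" for k
    using assms(2) seq_suble[OF r(1), of "Suc k"] by (cases "r (Suc k)") simp_all
  moreover have "(\<lambda>k. (x \<circ> r) (Suc k)) \<longlonglongrightarrow> l"
    using r(2) by (rule LIMSEQ_Suc)
  ultimately show ?thesis
    by (rule closed_sequentially[OF assms(1)])
qed

theorem proposition2:
  fixes T :: "real^'n^'n" and b :: "real^'n"
  assumes "invertible T"
    and "\<And>x :: real^'n. invertible (P_mat x + T)"
  shows "\<forall>x0. (\<exists>!x. iteration_from T b x0 x) \<and>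
    (\<forall>x. iteration_from T b x0 x \<longrightarrow>
      (\<forall>k. \<exists>!y. (P_mat (x k) + T) *v y = b) \<and>
      bounded (range x) \<and>
      (\<forall>xbar. accumulation_point x xbar \<longrightarrow>
        (\<exists>xhat. (P_mat xhat + T) *v xbar = b) \<and>
        (\<forall>xhat. (P_mat xhat + T) *v xbar = b \<longrightarrow>
           sgn_vec (pos_vec xbar) = sgn_vec (pos_vec xhat) \<longrightarrow>
           pos_vec xbar + T *v xbar = b)))"
proof (intro allI conjI impI)
  fix x0 show "\<exists>!x. iteration_from T b x0 x"
    by (rule ex1_iteration_from[OF assms(2)])
next
  fix x :: "nat \<Rightarrow> real^'n" and k show "\<exists>!y. (P_mat (x k) + T) *v y = b"
    by (simp add: invertible_matrix_vector_eq_iff[OF assms(2)])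
next
  fix x0 x assume x: "iteration_from T b x0 x"
  let ?S = "{y. \<exists>z. (P_mat z + T) *v y = b}"
  have fin: "finite ?S"
    by (rule finite_P_mat_solutions[OF assms(2)])
  have S: "x (Suc k) \<in> ?S" for k
    using x unfolding iteration_from_def by blast
  \<comment> \<open>The starting point is arbitrary and need not solve any of the systems.\<close>
  have "x k \<in> insert (x 0) ?S" for k
    using S by (cases k) auto
  then have "finite (range x)"
    using fin by (intro finite_subset[of "range x" "insert (x 0) ?S"]) auto
  then show "bounded (range x)"
    by (rule finite_imp_bounded)
  fix xbar assume acc: "accumulation_point x xbar"
  show "\<exists>xhat. (P_mat xhat + T) *v xbar = b"
    using accumulation_point_in_closed[where S = ?S and x = x, OF finite_imp_closed[OF fin] S acc]
    by (rule CollectD)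
next
  fix xbar xhat
  assume "(P_mat xhat + T) *v xbar = b" "sgn_vec (pos_vec xbar) = sgn_vec (pos_vec xhat)"
  \<comment> \<open>Equal sign vectors give \<open>P_mat xbar = P_mat xhat\<close>.\<close>
  then have "(P_mat xbar + T) *v xbar = b"
    by (simp add: P_mat_def)
  then show "pos_vec xbar + T *v xbar = b"
    by (simp add: matrix_vector_mult_add_rdistrib P_mat_mult_self)
qed

end
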